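(* Let $\{a_j\}_{j\in\mathbb{Z}}\subset\mathbb{R}^+$, $\{c_m\}_{m\in\mathbb{Z}}\subset\mathbb{R}$, $b\neq 0$ real, and let $\Theta:L^2(\mathbb{R})\to L^2(\mathbb{R})$ be a bounded linear operator such that $\Theta^*$ is hyponormal. Let $p\geq 1$, $\Lambda_p=\{1,2,\dots,p\}$, and let $\psi_s\in L^2(\mathbb{R})$ $(s\in\Lambda_p)$ be such that, for each $s\in\Lambda_p$, $\{D_{a_j}T_{bk}E_{c_m}\psi_s\}_{j,k,m\in\mathbb{Z}}$ is a $\Theta$-$IWH$ wave packet frame for $L^2(\mathbb{R})$. Let $\alpha_1,\dots,\alpha_p$ be any nonzero scalars. Then $$\mathcal{F}_p=\Big\{\sum_{s=1}^{p}\alpha_sD_{a_j}T_{bk}E_{c_m}\psi_s\Big\}_{j,k,m\in\mathbb{Z}}$$ is a $\Theta$-$IWH$ wave packet frame for $L^2(\mathbb{R})$ if and only if there exist $\mu>0$ and some $\xi\in\Lambda_p$ such that $$\mu\sum_{j,k,m\in\mathbb{Z}}|\langle D_{a_j}T_{bk}E_{c_m}\psi_\xi,f\rangle|^2\leq\sum_{j,k,m\in\mathbb{Z}}\Big|\Big\langle\sum_{s=1}^p\alpha_sD_{a_j}T_{bk}E_{c_m}\psi_s,f\Big\rangle\Big|^2\quad\text{for all } f\in L^2(\mathbb{R}).$$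
   Context: For $f\in L^2(\mathbb{R})$: $T_af(t)=f(t-a)$ (translation, $a\in\mathbb{R}$), $E_bf(t)=e^{2\pi i bt}f(t)$ (modulation, $b\in\mathbb{R}$), $D_cf(t)=|c|^{1/2}f(ct)$ (dilation, $c\neq0$). A bounded linear operator $S$ on a Hilbert space is hyponormal if $\|S^*f\|\leq\|Sf\|$ for all $f$; so $\Theta^*$ hyponormal means $\|\Theta f\|\leq\|\Theta^*f\|$ for all $f$. Definition. For a bounded linear operator $\Theta$ on $L^2(\mathbb{R})$, a system $\{g_{j,k,m}\}_{j,k,m\in\mathbb{Z}}\subset L^2(\mathbb{R})$ is called a $\Theta$-$IWH$ ($\Theta$-irregular Weyl-Heisenberg) wave packet frame for $L^2(\mathbb{R})$ if there exist constants $0<\alpha_0\leq\beta_0<\infty$ such that $$\alpha_0\|\Theta^*f\|^2\leq\sum_{j,k,m\in\mathbb{Z}}|\langle f,g_{j,k,m}\rangle|^2\leq\beta_0\|\Theta f\|^2\quad\text{for all } f\in L^2(\mathbb{R}).$$ *)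

theory Defs
  imports "HOL-Analysis.Analysis"
begin

text \<open>Representatives are Borel functions; since every Lebesgue measurable function agrees almost
  everywhere with a Borel function, this gives the usual complex \<open>L\<^sup>2\<close> space of the line.\<close>

definition square_integrable :: "(real \<Rightarrow> complex) \<Rightarrow> bool" where
  "square_integrable f \<longleftrightarrow>
     f \<in> borel_measurable lborel \<and> integrable lborel (\<lambda>x. (cmod (f x))\<^sup>2)"

definition L2_eq :: "(real \<Rightarrow> complex) \<Rightarrow> (real \<Rightarrow> complex) \<Rightarrow> bool" where
  "L2_eq f g \<longleftrightarrow>
     square_integrable f \<and> square_integrable g \<and> (AE x in lborel. f x = g x)"

lemma measurable_cnj [measurable (raw)]:
  assumes "f \<in> borel_measurable M" shows "(\<lambda>x. cnj (f x)) \<in> borel_measurable M"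
  by (rule borel_measurable_continuous_on[OF _ assms]) (intro continuous_intros)

lemma square_integrable_scale:
  assumes "square_integrable f" shows "square_integrable (\<lambda>x. c * f x)"
  using assms by (auto simp: square_integrable_def norm_mult power_mult_distrib)

lemma square_integrable_add:
  assumes "square_integrable f" "square_integrable g"
  shows "square_integrable (\<lambda>x. f x + g x)"
proof -
  have [measurable]: "f \<in> borel_measurable lborel" "g \<in> borel_measurable lborel"
    using assms by (auto simp: square_integrable_def)
  have "(cmod (f x + g x))\<^sup>2 \<le> 2 * (cmod (f x))\<^sup>2 + 2 * (cmod (g x))\<^sup>2" for x
  proof -
    have "(cmod (f x + g x))\<^sup>2 \<le> (cmod (f x) + cmod (g x))\<^sup>2"
      by (intro power_mono norm_triangle_ineq) auto
    also have "\<dots> \<le> 2 * (cmod (f x))\<^sup>2 + 2 * (cmod (g x))\<^sup>2"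
      using zero_le_power2[of "cmod (f x) - cmod (g x)"]
      by (simp add: power2_eq_square algebra_simps)
    finally show ?thesis .
  qed
  moreover have "integrable lborel (\<lambda>x. 2 * (cmod (f x))\<^sup>2 + 2 * (cmod (g x))\<^sup>2)"
    using assms by (auto simp: square_integrable_def)
  ultimately have "integrable lborel (\<lambda>x. (cmod (f x + g x))\<^sup>2)"
    by (intro Bochner_Integration.integrable_bound[where g = "\<lambda>x. (cmod (f x + g x))\<^sup>2"
          and f = "\<lambda>x. 2 * (cmod (f x))\<^sup>2 + 2 * (cmod (g x))\<^sup>2"]) auto
  then show ?thesis
    by (simp add: square_integrable_def)
qed

lemma square_integrable_product:
  assumes "square_integrable f" "square_integrable g"
  shows "integrable lborel (\<lambda>x. f x * cnj (g x))"
proof -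
  have [measurable]: "f \<in> borel_measurable lborel" "g \<in> borel_measurable lborel"
    using assms by (auto simp: square_integrable_def)
  have "cmod (f x * cnj (g x)) \<le> (cmod (f x))\<^sup>2 + (cmod (g x))\<^sup>2" for x
    using sum_squares_bound[of "cmod (f x)" "cmod (g x)"]
      mult_nonneg_nonneg[OF norm_ge_zero[of "f x"] norm_ge_zero[of "g x"]]
    unfolding norm_mult complex_mod_cnj by linarith
  moreover have "integrable lborel (\<lambda>x. (cmod (f x))\<^sup>2 + (cmod (g x))\<^sup>2)"
    using assms by (auto simp: square_integrable_def)
  ultimately show ?thesis
    by (intro Bochner_Integration.integrable_bound[where g = "\<lambda>x. f x * cnj (g x)"
          and f = "\<lambda>x. (cmod (f x))\<^sup>2 + (cmod (g x))\<^sup>2"]) (auto intro: order_trans)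
qed

lemma square_integrable_affine:
  assumes "square_integrable f" "c \<noteq> 0"
  shows "square_integrable (\<lambda>x. f (t + c * x))"
proof -
  have [measurable]: "f \<in> borel_measurable borel"
    using assms by (auto simp: square_integrable_def)
  show ?thesis
    using lborel_integrable_real_affine[of "\<lambda>x. (cmod (f x))\<^sup>2" c t] assms
    by (auto simp: square_integrable_def)
qed

lemma L2_eq_affine:
  assumes "L2_eq f g" "c \<noteq> 0"
  shows "L2_eq (\<lambda>x. f (t + c * x)) (\<lambda>x. g (t + c * x))"
proof -
  have [measurable]: "f \<in> borel_measurable borel" "g \<in> borel_measurable borel"
    using assms by (auto simp: L2_eq_def square_integrable_def)
  have "AE x in lborel. f (t + c * x) = g (t + c * x)"
    using assms by (intro AE_borel_affine) (auto simp: L2_eq_def)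
  then show ?thesis
    using assms by (auto simp: L2_eq_def square_integrable_affine)
qed

quotient_type L2 = "real \<Rightarrow> complex" / partial: L2_eq
proof (rule part_equivpI)
  show "\<exists>f. L2_eq f f"
    by (rule exI[of _ "\<lambda>_. 0"]) (simp add: L2_eq_def square_integrable_def)
  show "symp L2_eq"
    by (auto simp: L2_eq_def symp_def elim: eventually_mono)
  show "transp L2_eq"
    unfolding transp_def L2_eq_def by (auto elim: eventually_elim2)
qed

lift_definition cinner :: "L2 \<Rightarrow> L2 \<Rightarrow> complex"
  is "\<lambda>f g. \<integral>x. f x * cnj (g x) \<partial>lborel"
  by (intro integral_cong_AE) (auto simp: L2_eq_def square_integrable_def elim: eventually_elim2)

lift_definition scaleC :: "complex \<Rightarrow> L2 \<Rightarrow> L2" (infixr "*\<^sub>C" 75)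
  is "\<lambda>c f x. c * f x"
  by (auto simp: L2_eq_def square_integrable_scale elim: eventually_mono)

instantiation L2 :: real_vector
begin

lift_definition zero_L2 :: L2 is "\<lambda>_. 0"
  by (simp add: L2_eq_def square_integrable_def)

lift_definition plus_L2 :: "L2 \<Rightarrow> L2 \<Rightarrow> L2" is "\<lambda>f g x. f x + g x"
  by (auto simp: L2_eq_def square_integrable_add elim: eventually_elim2)

definition uminus_L2 :: "L2 \<Rightarrow> L2" where "- f = (- 1) *\<^sub>C f"

definition minus_L2 :: "L2 \<Rightarrow> L2 \<Rightarrow> L2" where "f - g = f + - g" for f g :: L2

definition scaleR_L2 :: "real \<Rightarrow> L2 \<Rightarrow> L2" where "r *\<^sub>R f = complex_of_real r *\<^sub>C f"

instance
proof
  fix f g h :: L2 and r s :: real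
  show "f + g + h = f + (g + h)"
    by transfer (auto simp: L2_eq_def square_integrable_add add.assoc)
  show "f + g = g + f"
    by transfer (auto simp: L2_eq_def square_integrable_add add.commute)
  show "0 + f = f"
    by transfer (auto simp: L2_eq_def)
  show "- f + f = 0"
    unfolding uminus_L2_def by transfer (auto simp: L2_eq_def square_integrable_def)
  show "f - g = f + - g" by (fact minus_L2_def)
  show "r *\<^sub>R (f + g) = r *\<^sub>R f + r *\<^sub>R g"
    unfolding scaleR_L2_def
    by transfer (auto simp: L2_eq_def square_integrable_add square_integrable_scale distrib_left)
  show "(r + s) *\<^sub>R f = r *\<^sub>R f + s *\<^sub>R f"
    unfolding scaleR_L2_def
    by transfer (auto simp: L2_eq_def distrib_right
        intro!: square_integrable_add square_integrable_scale)
  show "r *\<^sub>R s *\<^sub>R f = (r * s) *\<^sub>R f"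
    unfolding scaleR_L2_def
    by transfer (auto simp: L2_eq_def mult.assoc intro!: square_integrable_scale)
  show "1 *\<^sub>R f = f"
    unfolding scaleR_L2_def by transfer (auto simp: L2_eq_def)
qed

end

instantiation L2 :: real_inner
begin

text \<open>The class \<^class>\<open>real_inner\<close> uses the real part of the inner product; the induced norm is the
  usual one.\<close>

definition inner_L2 :: "L2 \<Rightarrow> L2 \<Rightarrow> real" where "inner f g = Re (cinner f g)"

definition norm_L2 :: "L2 \<Rightarrow> real" where "norm f = sqrt (inner f f)" for f :: L2

definition dist_L2 :: "L2 \<Rightarrow> L2 \<Rightarrow> real" where "dist f g = norm (f - g)" for f g :: L2

definition sgn_L2 :: "L2 \<Rightarrow> L2" where "sgn f = f /\<^sub>R norm f" for f :: L2

definition uniformity_L2 :: "(L2 \<times> L2) filter" where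
  "uniformity_L2 = (INF e\<in>{0<..}. principal {(x, y). dist x y < e})"

definition open_L2 :: "L2 set \<Rightarrow> bool" where
  "open_L2 U = (\<forall>x\<in>U. \<forall>\<^sub>F (x', y) in uniformity. x' = x \<longrightarrow> y \<in> U)"

instance
proof
  fix f g h :: L2 and r :: real
  show "dist f g = norm (f - g)" by (fact dist_L2_def)
  show "sgn f = f /\<^sub>R norm f" by (fact sgn_L2_def)
  show "uniformity = (INF e\<in>{0<..}. principal {(x, y :: L2). dist x y < e})"
    by (fact uniformity_L2_def)
  show "open U = (\<forall>x\<in>U. \<forall>\<^sub>F (x', y) in uniformity. x' = x \<longrightarrow> y \<in> U)" for U :: "L2 set"
    by (fact open_L2_def)
  show "inner f g = inner g f"
    unfolding inner_L2_def
  proof transfer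
    fix f g
    have "(\<integral>x. f x * cnj (g x) \<partial>lborel) = (\<integral>x. cnj (g x * cnj (f x)) \<partial>lborel)"
      by (simp add: mult.commute)
    also have "\<dots> = cnj (\<integral>x. g x * cnj (f x) \<partial>lborel)"
      by (rule Bochner_Integration.integral_cnj)
    finally show "Re (\<integral>x. f x * cnj (g x) \<partial>lborel) = Re (\<integral>x. g x * cnj (f x) \<partial>lborel)"
      by simp
  qed
  show "inner (f + g) h = inner f h + inner g h"
    unfolding inner_L2_def
    by transfer (simp add: L2_eq_def square_integrable_product distrib_right)
  show "inner (r *\<^sub>R f) g = r * inner f g"
    unfolding inner_L2_def scaleR_L2_def
    by transfer (simp add: mult.assoc)
  have sq: "Re (\<integral>x. F x * cnj (F x) \<partial>lborel) = (\<integral>x. (cmod (F x))\<^sup>2 \<partial>lborel)" for F :: "real \<Rightarrow> complex"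
    by (simp add: complex_norm_square[symmetric] del: of_real_power)
  show "0 \<le> inner f f"
    unfolding inner_L2_def by transfer (simp add: sq)
  show "inner f f = 0 \<longleftrightarrow> f = 0"
    unfolding inner_L2_def
  proof transfer
    fix F assume F: "L2_eq F F"
    then have "integrable lborel (\<lambda>x. (cmod (F x))\<^sup>2)"
      by (simp add: L2_eq_def square_integrable_def)
    then have "(\<integral>x. (cmod (F x))\<^sup>2 \<partial>lborel) = 0 \<longleftrightarrow> (AE x in lborel. F x = 0)"
      by (subst integral_nonneg_eq_0_iff_AE) auto
    then show "Re (\<integral>x. F x * cnj (F x) \<partial>lborel) = 0 \<longleftrightarrow> L2_eq F (\<lambda>_. 0)"
      unfolding sq using F by (auto simp: L2_eq_def square_integrable_def)
  qed
  show "norm f = sqrt (inner f f)" by (fact norm_L2_def)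
qed

end

lift_definition translation :: "real \<Rightarrow> L2 \<Rightarrow> L2"
  is "\<lambda>a f t. f (t - a)"
  using L2_eq_affine[where c = 1 and t = "- a" for a] by simp

lift_definition modulation :: "real \<Rightarrow> L2 \<Rightarrow> L2"
  is "\<lambda>b f t. exp (2 * of_real pi * \<i> * of_real b * of_real t) * f t"
  by (auto simp: L2_eq_def square_integrable_def norm_mult elim: eventually_mono)

text \<open>For \<open>c = 0\<close> this is the zero operator.\<close>

lift_definition dilation :: "real \<Rightarrow> L2 \<Rightarrow> L2"
  is "\<lambda>c f t. of_real (sqrt \<bar>c\<bar>) * f (c * t)"
proof -
  fix c :: real and f g assume fg: "L2_eq f g"
  show "L2_eq (\<lambda>t. of_real (sqrt \<bar>c\<bar>) * f (c * t)) (\<lambda>t. of_real (sqrt \<bar>c\<bar>) * g (c * t))"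
  proof (cases "c = 0")
    case True
    then show ?thesis by (simp add: L2_eq_def square_integrable_def)
  next
    case False
    then have "L2_eq (\<lambda>t. f (c * t)) (\<lambda>t. g (c * t))"
      using L2_eq_affine[OF fg False, of 0] by simp
    then show ?thesis
      by (auto simp: L2_eq_def square_integrable_scale elim: eventually_mono)
  qed
qed

definition bounded_operator :: "(L2 \<Rightarrow> L2) \<Rightarrow> bool" where
  "bounded_operator S \<longleftrightarrow> bounded_linear S \<and> (\<forall>c f. S (c *\<^sub>C f) = c *\<^sub>C S f)"

text \<open>The Hilbert space adjoint. For a bounded operator it exists by the Riesz representation
  theorem, and it is unique because \<^const>\<open>cinner\<close> is nondegenerate. (The library constant
  \<open>adjoint\<close> refers to the real inner product instead.)\<close>

definition adj :: "(L2 \<Rightarrow> L2) \<Rightarrow> (L2 \<Rightarrow> L2)" where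
  "adj S = (THE T. \<forall>f g. cinner (S f) g = cinner f (T g))"

definition hyponormal :: "(L2 \<Rightarrow> L2) \<Rightarrow> bool" where
  "hyponormal S \<longleftrightarrow> bounded_operator S \<and> (\<forall>f. norm (adj S f) \<le> norm (S f))"

text \<open>The sums range over all integer triples and are taken in \<^typ>\<open>ennreal\<close>, so that a divergent sum
  has the value \<open>\<infinity>\<close> and an upper bound by a real number includes convergence.\<close>

definition frame_sum :: "(int \<Rightarrow> int \<Rightarrow> int \<Rightarrow> L2) \<Rightarrow> L2 \<Rightarrow> ennreal" where
  "frame_sum g f = (\<Sum>\<^sub>\<infinity>(j, k, m)\<in>UNIV. ennreal ((cmod (cinner f (g j k m)))\<^sup>2))"

definition IWH_wave_packet_frame :: "(L2 \<Rightarrow> L2) \<Rightarrow> (int \<Rightarrow> int \<Rightarrow> int \<Rightarrow> L2) \<Rightarrow> bool" where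
  "IWH_wave_packet_frame \<Theta> g \<longleftrightarrow>
     (\<exists>\<alpha>\<^sub>0 \<beta>\<^sub>0 :: real. 0 < \<alpha>\<^sub>0 \<and> \<alpha>\<^sub>0 \<le> \<beta>\<^sub>0 \<and>
        (\<forall>f. ennreal (\<alpha>\<^sub>0 * (norm (adj \<Theta> f))\<^sup>2) \<le> frame_sum g f \<and>
             frame_sum g f \<le> ennreal (\<beta>\<^sub>0 * (norm (\<Theta> f))\<^sup>2)))"

end

theory Submission
  imports Defs
begin

text \<open>
  Write \<open>\<Sigma>\<^sub>s(f)\<close> for the frame sum of the \<open>s\<close>-th family and \<open>\<Sigma>(f)\<close> for that of the linear
  combination, and let \<open>A\<^sub>s\<close>, \<open>B\<^sub>s\<close> be frame bounds of the \<open>s\<close>-th family. The equivalence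
  is a statement about finitely many \<open>\<Theta>\<close>-frames (\<open>IWH_wave_packet_frame_combination_iff\<close>).

  If the combination is a frame with lower bound \<open>A\<^sub>0\<close>, then hyponormality of \<open>\<Theta>\<^sup>*\<close> links the upper bound
  of any single family to it:
  \<open>A\<^sub>0 / B\<^sub>\<xi> \<cdot> \<Sigma>\<^sub>\<xi>(f) \<le> A\<^sub>0 \<parallel>\<Theta> f\<parallel>\<^sup>2 \<le> A\<^sub>0 \<parallel>\<Theta>\<^sup>* f\<parallel>\<^sup>2 \<le> \<Sigma>(f)\<close>. Hence \<open>\<mu> = A\<^sub>0 / B\<^sub>\<xi>\<close> works for every \<open>\<xi>\<close>.
  Conversely, \<open>\<mu> \<Sigma>\<^sub>\<xi>(f) \<le> \<Sigma>(f)\<close> passes the lower bound of the family \<open>\<xi>\<close> on to the combination, while its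
  upper bound always exists: by the Cauchy-Schwarz inequality for finite sums, \<open>\<Sigma>(f)\<close> is at most a
  linear combination of the \<open>\<Sigma>\<^sub>s(f)\<close> (\<open>frame_sum_combination_le\<close>).

  The analytic substance lies in the inequality \<open>\<parallel>\<Theta> f\<parallel> \<le> \<parallel>\<Theta>\<^sup>* f\<parallel>\<close>. Hyponormality of \<open>\<Theta>\<^sup>*\<close> literally
  compares \<open>\<Theta>\<^sup>*\<^sup>*\<close> with \<open>\<Theta>\<^sup>*\<close>, so one has to know that \<open>\<Theta>\<^sup>*\<^sup>* = \<Theta>\<close> (\<open>adj_adj\<close>). As \<^const>\<open>adj\<close> is a definite
  description, this requires that the adjoint exists, hence the Riesz representation theorem, hence the
  completeness of \<open>L\<^sup>2\<close> (the Riesz-Fischer theorem).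
\<close>

section \<open>Completeness of the space\<close>

lemma L2_eq_refl_iff: "L2_eq f f \<longleftrightarrow> square_integrable f"
  by (auto simp: L2_eq_def)

lemma square_integrable_rep_L2: "square_integrable (rep_L2 f)"
  using Quotient3_rep_reflp[OF Quotient3_L2] by (simp add: L2_eq_refl_iff)

lemma abs_rep_L2: "abs_L2 (rep_L2 f) = f"
  by (rule Quotient3_abs_rep[OF Quotient3_L2])

lemma abs_L2_diff:
  assumes "square_integrable f" "square_integrable g"
  shows "abs_L2 f - abs_L2 g = abs_L2 (\<lambda>x. f x - g x)"
  using assms
  by (simp add: minus_L2_def uminus_L2_def scaleC.abs_eq plus_L2.abs_eq L2_eq_refl_iff
      square_integrable_scale[of g "-1", simplified])

lemma nn_integral_norm_abs_L2:
  assumes "square_integrable f"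
  shows "(\<integral>\<^sup>+x. ennreal ((cmod (f x))\<^sup>2) \<partial>lborel) = ennreal ((norm (abs_L2 f))\<^sup>2)"
proof -
  have i: "integrable lborel (\<lambda>x. (cmod (f x))\<^sup>2)"
    using assms by (simp add: square_integrable_def)
  have "cinner (abs_L2 f) (abs_L2 f) = (\<integral>x. f x * cnj (f x) \<partial>lborel)"
    using assms by (simp add: cinner.abs_eq L2_eq_refl_iff)
  also have "\<dots> = of_real (\<integral>x. (cmod (f x))\<^sup>2 \<partial>lborel)"
    by (simp add: complex_norm_square[symmetric] del: of_real_power)
  finally have "(norm (abs_L2 f))\<^sup>2 = (\<integral>x. (cmod (f x))\<^sup>2 \<partial>lborel)"
    by (simp add: power2_norm_eq_inner inner_L2_def)
  then show ?thesis
    using nn_integral_eq_integral[OF i] by simp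
qed

lemma nn_integral_dist_rep_L2:
  "(\<integral>\<^sup>+x. ennreal ((cmod (rep_L2 f x - rep_L2 g x))\<^sup>2) \<partial>lborel) = ennreal ((dist f g)\<^sup>2)"
proof -
  have "square_integrable (\<lambda>x. rep_L2 f x - rep_L2 g x)"
    using square_integrable_add[OF square_integrable_rep_L2[of f]
        square_integrable_scale[OF square_integrable_rep_L2[of g], of "-1"]] by simp
  then show ?thesis
    using abs_L2_diff[OF square_integrable_rep_L2[of f] square_integrable_rep_L2[of g]]
    by (simp add: nn_integral_norm_abs_L2 dist_norm abs_rep_L2)
qed

text \<open>Prescribed rates make the increments summable, which is how norm convergence is turned into pointwise
  convergence below.\<close>

lemma Cauchy_fast_subseq:
  fixes X :: "nat \<Rightarrow> 'a::metric_space"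
  assumes "Cauchy X" "\<And>n. e n > 0"
  obtains r :: "nat \<Rightarrow> nat" where "strict_mono r" "\<And>n. dist (X (r (Suc n))) (X (r n)) < e n"
proof -
  have "\<exists>N. \<forall>m\<ge>N. \<forall>n\<ge>N. dist (X m) (X n) < e k" for k
    using assms unfolding Cauchy_def by blast
  then obtain N where N: "\<And>k m n. m \<ge> N k \<Longrightarrow> n \<ge> N k \<Longrightarrow> dist (X m) (X n) < e k"
    by metis
  define r where "r n = (\<Sum>k\<le>n. Suc (N k))" for n
  have "strict_mono r"
    by (simp add: strict_mono_Suc_iff r_def)
  moreover have "N n \<le> r n" for n
  proof -
    have "N n \<le> Suc (N n)" by simp
    also have "\<dots> \<le> r n" unfolding r_def by (rule member_le_sum) auto
    finally show ?thesis .
  qed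
  moreover have "r n \<le> r (Suc n)" for n
    by (simp add: r_def)
  ultimately show ?thesis
    using that[of r] N by (meson le_trans)
qed

text \<open>The hypothesis bounds the terms of the series, so the increments are \<open>O(2\<^sup>-\<^sup>n)\<close> and the sequence telescopes
  into an absolutely convergent series. The condition is on squares because
  their weighted sums can be integrated termwise.\<close>

lemma convergent_if_weighted_square_summable:
  fixes v :: "nat \<Rightarrow> complex"
  assumes "summable (\<lambda>n. 4 ^ n * (cmod (v (Suc n) - v n))\<^sup>2)"
  shows "convergent v"
proof -
  obtain K where "K > 0" and K: "\<And>n. norm (4 ^ n * (cmod (v (Suc n) - v n))\<^sup>2) \<le> K"
    using summable_imp_Bseq[OF assms] unfolding Bseq_def by auto
  have "norm (v (Suc n) - v n) \<le> sqrt K * (1 / 2) ^ n" for n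
  proof -
    have "(4::real) ^ n = (2 ^ n)\<^sup>2"
      by (simp add: power2_eq_square flip: power_mult_distrib)
    then have "(2 ^ n * cmod (v (Suc n) - v n))\<^sup>2 \<le> K"
      using K[of n] by (simp add: power_mult_distrib)
    then have "2 ^ n * cmod (v (Suc n) - v n) \<le> sqrt K"
      by (rule real_le_rsqrt)
    then show ?thesis
      by (simp add: power_one_over pos_le_divide_eq mult.commute)
  qed
  moreover have "summable (\<lambda>n. sqrt K * (1 / 2 :: real) ^ n)"
    by (intro summable_mult summable_geometric) simp
  ultimately have "summable (\<lambda>n. v (Suc n) - v n)"
    by (rule summable_comparison_test'[rotated])
  then have "convergent (\<lambda>n. \<Sum>i<n. v (Suc i) - v i)"
    by (simp add: summable_iff_convergent)
  then have "convergent (\<lambda>n. (v n - v 0) + v 0)"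
    unfolding sum_lessThan_telescope by (intro convergent_add convergent_const)
  then show ?thesis
    by simp
qed

text \<open>The increments satisfy \<open>\<Sum>\<^sub>n 4\<^sup>n \<parallel>Y\<^sub>n\<^sub>+\<^sub>1 - Y\<^sub>n\<parallel>\<^sup>2 \<le> \<Sum>\<^sub>n 4\<^sup>-\<^sup>n < \<infinity>\<close>. By monotone convergence this is the
  integral of \<open>\<Sum>\<^sub>n 4\<^sup>n |u\<^sub>n\<^sub>+\<^sub>1(x) - u\<^sub>n(x)|\<^sup>2\<close>, which is therefore finite for almost every \<open>x\<close>.\<close>

lemma rep_L2_AE_convergent:
  fixes Y :: "nat \<Rightarrow> L2"
  assumes Y: "\<And>n. dist (Y (Suc n)) (Y n) < (1 / 4) ^ n"
  shows "AE x in lborel. convergent (\<lambda>n. rep_L2 (Y n) x)"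
proof -
  define u where "u n = rep_L2 (Y n)" for n
  have [measurable]: "u n \<in> borel_measurable lborel" for n
    using square_integrable_rep_L2[of "Y n"] by (simp add: u_def square_integrable_def)
  let ?w = "\<lambda>n x. 4 ^ n * (cmod (u (Suc n) x - u n x))\<^sup>2"
  have le: "(\<integral>\<^sup>+x. ennreal (?w n x) \<partial>lborel) \<le> ennreal ((1 / 4) ^ n)" for n
  proof -
    have "(\<integral>\<^sup>+x. ennreal (?w n x) \<partial>lborel)
        = ennreal (4 ^ n) * (\<integral>\<^sup>+x. ennreal ((cmod (u (Suc n) x - u n x))\<^sup>2) \<partial>lborel)"
      by (subst nn_integral_cmult[symmetric]) (auto simp: ennreal_mult)
    also have "\<dots> = ennreal (4 ^ n * (dist (Y (Suc n)) (Y n))\<^sup>2)"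
      by (simp add: u_def nn_integral_dist_rep_L2 ennreal_mult)
    also have "\<dots> \<le> ennreal (4 ^ n * ((1 / 4) ^ n)\<^sup>2)"
      using Y[of n] by (intro ennreal_leI mult_left_mono power_mono) auto
    also have "(4::real) ^ n * ((1 / 4) ^ n)\<^sup>2 = (1 / 4) ^ n"
      by (simp add: power2_eq_square power_one_over)
    finally show ?thesis .
  qed
  have "(\<integral>\<^sup>+x. (\<Sum>n. ennreal (?w n x)) \<partial>lborel) = (\<Sum>n. \<integral>\<^sup>+x. ennreal (?w n x) \<partial>lborel)"
    by (rule nn_integral_suminf) measurable
  also have "\<dots> \<le> (\<Sum>n. ennreal ((1 / 4) ^ n))"
    by (intro suminf_le le) auto
  also have "\<dots> = ennreal (\<Sum>n. (1 / 4) ^ n)"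
    by (rule suminf_ennreal2) (auto intro: summable_geometric)
  finally have "(\<integral>\<^sup>+x. (\<Sum>n. ennreal (?w n x)) \<partial>lborel) \<noteq> \<infinity>"
    unfolding infinity_ennreal_def by (rule neq_top_trans[OF ennreal_neq_top])
  then have "AE x in lborel. (\<Sum>n. ennreal (?w n x)) \<noteq> \<infinity>"
    by (intro nn_integral_PInf_AE) measurable
  then show ?thesis
  proof (rule AE_mp, intro AE_I2 impI)
    fix x assume "(\<Sum>n. ennreal (?w n x)) \<noteq> \<infinity>"
    then have "summable (\<lambda>n. ?w n x)"
      unfolding infinity_ennreal_def by (rule summable_suminf_not_top[rotated]) simp
    then show "convergent (\<lambda>n. rep_L2 (Y n) x)"
      using convergent_if_weighted_square_summable[of "\<lambda>n. u n x"] by (simp add: u_def)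
  qed
qed

text \<open>Fatou's lemma carries the Cauchy estimate \<open>\<parallel>Y\<^sub>m - Y\<^sub>n\<parallel> < e\<close> over to the pointwise limit as \<open>m \<rightarrow> \<infinity>\<close>. This
  shows both that the limit is square integrable and that the convergence holds in norm.\<close>

lemma Cauchy_AE_convergent_imp_convergent:
  fixes Y :: "nat \<Rightarrow> L2"
  assumes Y: "Cauchy Y" and conv: "AE x in lborel. convergent (\<lambda>n. rep_L2 (Y n) x)"
  shows "convergent Y"
proof -
  define u where "u n = rep_L2 (Y n)" for n
  define F where "F x = lim (\<lambda>n. u n x)" for x
  have si: "square_integrable (u n)" for n
    by (simp add: u_def square_integrable_rep_L2)
  then have [measurable]: "u n \<in> borel_measurable lborel" for n
    by (simp add: square_integrable_def)
  have [measurable]: "F \<in> borel_measurable lborel"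
    unfolding F_def by measurable
  have lim: "AE x in lborel. (\<lambda>n. u n x) \<longlonglongrightarrow> F x"
    using conv by (rule eventually_mono) (simp add: u_def F_def convergent_LIMSEQ_iff)
  have fatou: "(\<integral>\<^sup>+x. ennreal ((cmod (F x - u n x))\<^sup>2) \<partial>lborel) \<le> ennreal (e\<^sup>2)"
    if N: "\<forall>m\<ge>N. dist (Y m) (Y n) < e" for n N e
  proof -
    have "(\<integral>\<^sup>+x. ennreal ((cmod (F x - u n x))\<^sup>2) \<partial>lborel)
        = (\<integral>\<^sup>+x. liminf (\<lambda>m. ennreal ((cmod (u m x - u n x))\<^sup>2)) \<partial>lborel)"
    proof (rule nn_integral_cong_AE, rule AE_mp[OF lim], intro AE_I2 impI)
      fix x assume "(\<lambda>n. u n x) \<longlonglongrightarrow> F x"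
      then have "(\<lambda>m. ennreal ((cmod (u m x - u n x))\<^sup>2)) \<longlonglongrightarrow> ennreal ((cmod (F x - u n x))\<^sup>2)"
        by (intro tendsto_intros)
      then show "ennreal ((cmod (F x - u n x))\<^sup>2) = liminf (\<lambda>m. ennreal ((cmod (u m x - u n x))\<^sup>2))"
        by (intro lim_imp_Liminf[symmetric]) auto
    qed
    also have "\<dots> \<le> liminf (\<lambda>m. \<integral>\<^sup>+x. ennreal ((cmod (u m x - u n x))\<^sup>2) \<partial>lborel)"
      by (rule nn_integral_liminf) measurable
    also have "\<dots> = liminf (\<lambda>m. ennreal ((dist (Y m) (Y n))\<^sup>2))"
      by (simp add: u_def nn_integral_dist_rep_L2)
    also have "\<dots> \<le> ennreal (e\<^sup>2)"
    proof (rule Liminf_le)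
      show "\<forall>\<^sub>F m in sequentially. ennreal ((dist (Y m) (Y n))\<^sup>2) \<le> ennreal (e\<^sup>2)"
        using eventually_ge_at_top[of N]
        by eventually_elim (use N in \<open>auto intro!: ennreal_leI power_mono intro: less_imp_le\<close>)
    qed auto
    finally show ?thesis .
  qed
  have sid: "square_integrable (\<lambda>x. F x - u n x)"
    if N: "\<forall>m\<ge>N. dist (Y m) (Y n) < e" for n N e
    using le_less_trans[OF fatou[OF N] ennreal_less_top]
    by (simp add: square_integrable_def integrable_iff_bounded)
  obtain N0 where "\<forall>m\<ge>N0. dist (Y m) (Y N0) < 1"
    using Y unfolding Cauchy_def by (metis order_refl zero_less_one)
  from square_integrable_add[OF sid[OF this] si[of N0]]
  have F: "square_integrable F" by simp
  have "Y \<longlonglongrightarrow> abs_L2 F"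
  proof (rule metric_LIMSEQ_I)
    fix e :: real assume "e > 0"
    then obtain N where N: "\<And>m n. m \<ge> N \<Longrightarrow> n \<ge> N \<Longrightarrow> dist (Y m) (Y n) < e / 2"
      using Y unfolding Cauchy_def by (meson half_gt_zero)
    have "dist (Y n) (abs_L2 F) < e" if "n \<ge> N" for n
    proof -
      have Nn: "\<forall>m\<ge>N. dist (Y m) (Y n) < e / 2" using N that by simp
      have "ennreal ((dist (abs_L2 F) (Y n))\<^sup>2) \<le> ennreal ((e / 2)\<^sup>2)"
        using fatou[OF Nn] nn_integral_norm_abs_L2[OF sid[OF Nn]] abs_L2_diff[OF F si[of n]]
        by (simp add: dist_norm u_def abs_rep_L2)
      then have "(dist (abs_L2 F) (Y n))\<^sup>2 \<le> (e / 2)\<^sup>2"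
        by simp
      then have "dist (abs_L2 F) (Y n) \<le> e / 2"
        by (rule power2_le_imp_le) (use \<open>e > 0\<close> in simp)
      then show ?thesis
        using \<open>e > 0\<close> by (simp add: dist_commute)
    qed
    then show "\<exists>N. \<forall>n\<ge>N. dist (Y n) (abs_L2 F) < e"
      by (intro exI[of _ N]) simp
  qed
  then show ?thesis
    by (rule convergentI)
qed

instance L2 :: complete_space
proof
  fix X :: "nat \<Rightarrow> L2" assume X: "Cauchy X"
  obtain r :: "nat \<Rightarrow> nat" where r: "strict_mono r"
    "\<And>n. dist (X (r (Suc n))) (X (r n)) < (1 / 4) ^ n"
    using Cauchy_fast_subseq[OF X, of "\<lambda>n. (1 / 4) ^ n"] by auto
  have "convergent (X \<circ> r)"
    using r Cauchy_subseq_Cauchy[OF X r(1)]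
    by (intro Cauchy_AE_convergent_imp_convergent rep_L2_AE_convergent) auto
  then show "convergent X"
    using Cauchy_converges_subseq[OF X r(1)] by (auto simp: convergent_def)
qed

section \<open>Riesz representation and adjoints\<close>

text \<open>The representing vector is the minimiser of the quadratic functional
  \<open>J(h) = \<parallel>h\<parallel>\<^sup>2 - 2 \<phi>(h)\<close>, which equals \<open>\<parallel>h - g\<parallel>\<^sup>2 - \<parallel>g\<parallel>\<^sup>2\<close> if \<open>g\<close> represents \<open>\<phi>\<close>. By the parallelogram law
  every minimising sequence is Cauchy, and the first variation of \<open>J\<close> at its limit vanishes.\<close>

theorem Riesz_representation_real:
  fixes \<phi> :: "'a::{real_inner,complete_space} \<Rightarrow> real"
  assumes "bounded_linear \<phi>"
  obtains g where "\<And>h. \<phi> h = inner h g"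
proof -
  interpret bounded_linear \<phi> by fact
  define J where "J h = (norm h)\<^sup>2 - 2 * \<phi> h" for h
  obtain K where K: "\<And>h. norm (\<phi> h) \<le> norm h * K"
    using bounded by blast
  have lower: "- K\<^sup>2 \<le> J h" for h
  proof -
    have "\<phi> h \<le> norm h * K" using K[of h] by auto
    moreover have "0 \<le> (norm h - K)\<^sup>2" by simp
    ultimately show ?thesis
      unfolding J_def power2_diff by linarith
  qed
  define M where "M = Inf (range J)"
  have bdd: "bdd_below (range J)"
    using lower by (auto intro!: bdd_belowI)
  have M: "M \<le> J h" for h
    unfolding M_def by (rule cInf_lower[OF _ bdd]) auto
  have "\<exists>h. J h < M + inverse (real (Suc n))" for n
    using cInf_lessD[of "range J" "M + inverse (real (Suc n))"] by (auto simp: M_def)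
  then obtain X where X: "\<And>n. J (X n) < M + inverse (real (Suc n))"
    by metis
  \<comment> \<open>Parallelogram law: two near-minimisers are close, since \<open>J\<close> at their midpoint is at least \<open>M\<close>.\<close>
  have mid: "(dist x y)\<^sup>2 \<le> 2 * (J x - M) + 2 * (J y - M)" for x y
  proof -
    have "J x + J y - 2 * J ((1/2) *\<^sub>R (x + y)) = (dist x y)\<^sup>2 / 2"
      unfolding J_def dist_norm power2_norm_eq_inner scaleR add
      by (simp add: inner_add inner_diff inner_commute field_simps)
    moreover note M[of "(1/2) *\<^sub>R (x + y)"]
    ultimately show ?thesis by argo
  qed
  have "Cauchy X"
  proof (rule metric_CauchyI)
    fix e :: real assume "e > 0"
    then obtain N where N: "inverse (real (Suc N)) < e\<^sup>2 / 4"
      using reals_Archimedean[of "e\<^sup>2 / 4"] by auto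
    have small: "J (X n) - M < e\<^sup>2 / 4" if "n \<ge> N" for n
    proof -
      have "inverse (real (Suc n)) \<le> inverse (real (Suc N))"
        using that by (intro le_imp_inverse_le) auto
      then show ?thesis using X[of n] N by linarith
    qed
    have "dist (X m) (X n) < e" if "m \<ge> N" "n \<ge> N" for m n
    proof -
      have "(dist (X m) (X n))\<^sup>2 < e\<^sup>2"
        using mid[of "X m" "X n"] small[OF that(1)] small[OF that(2)] by argo
      then show ?thesis
        using \<open>e > 0\<close> by (intro power2_less_imp_less[of _ e]) auto
    qed
    then show "\<exists>N. \<forall>m\<ge>N. \<forall>n\<ge>N. dist (X m) (X n) < e" by blast
  qed
  then obtain g where g: "X \<longlonglongrightarrow> g"
    using Cauchy_convergent by (auto simp: convergent_def)
  have "(\<lambda>n. J (X n)) \<longlonglongrightarrow> J g"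
    unfolding J_def by (intro tendsto_intros tendsto g)
  moreover have "(\<lambda>n. M + inverse (real (Suc n))) \<longlonglongrightarrow> M"
    using tendsto_add[OF tendsto_const[of M] LIMSEQ_inverse_real_of_nat] by simp
  ultimately have Jg: "J g \<le> M"
    using X by (intro LIMSEQ_le) (auto intro: less_imp_le)
  have "\<phi> h = inner h g" for h
  proof (rule ccontr)
    define d where "d = \<phi> h - inner h g"
    assume "\<phi> h \<noteq> inner h g"
    then have "d \<noteq> 0" by (simp add: d_def)
    \<comment> \<open>Moving from \<open>g\<close> along \<open>h\<close> by \<open>t = d / \<parallel>h\<parallel>\<^sup>2\<close> would minimise \<open>J\<close> on that line; adding 1 to the
      denominator still decreases \<open>J\<close> and avoids division by zero.\<close>
    define N where "N = (norm h)\<^sup>2 + 1"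
    have "N > 0" by (simp add: N_def add_nonneg_pos)
    define t where "t = d / N"
    have "J (g + t *\<^sub>R h) = J g - 2 * t * d + t\<^sup>2 * (norm h)\<^sup>2"
    proof -
      have "(norm (g + t *\<^sub>R h))\<^sup>2 = (norm g)\<^sup>2 + 2 * (t * inner h g) + t\<^sup>2 * (norm h)\<^sup>2"
        unfolding power2_norm_eq_inner
        by (simp add: inner_add inner_commute[of g h] power2_eq_square distrib_left mult.assoc)
      then show ?thesis
        unfolding J_def d_def scaleR add by (simp add: right_diff_distrib)
    qed
    then have "2 * t * d \<le> t\<^sup>2 * (norm h)\<^sup>2"
      using M[of "g + t *\<^sub>R h"] Jg by linarith
    also have "\<dots> \<le> t\<^sup>2 * N"
      by (intro mult_left_mono) (auto simp: N_def)
    also have "\<dots> = t * d"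
      using \<open>N > 0\<close> by (simp add: t_def power2_eq_square)
    finally have "t * d \<le> 0" by linarith
    moreover have "t * d = d\<^sup>2 / N" by (simp add: t_def power2_eq_square)
    then have "t * d > 0"
      using \<open>N > 0\<close> \<open>d \<noteq> 0\<close> by simp
    ultimately show False by linarith
  qed
  then show ?thesis using that by blast
qed

lemma cinner_commute: "cinner f g = cnj (cinner g f)"
proof transfer
  fix f g
  show "(\<integral>x. f x * cnj (g x) \<partial>lborel) = cnj (\<integral>x. g x * cnj (f x) \<partial>lborel)"
    by (subst Bochner_Integration.integral_cnj[symmetric]) (simp add: mult.commute)
qed

lemma cinner_scaleC_left: "cinner (c *\<^sub>C f) g = c * cinner f g"
  by transfer (simp add: mult.assoc)

lemma cinner_add_left: "cinner (f + g) h = cinner f h + cinner g h"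
  by transfer (simp add: L2_eq_def square_integrable_product distrib_right)

lemma cinner_scaleC_right: "cinner f (c *\<^sub>C g) = cnj c * cinner f g"
  using cinner_commute[of f "c *\<^sub>C g"] cinner_commute[of f g] by (simp add: cinner_scaleC_left)

lemma cinner_add_right: "cinner f (g + h) = cinner f g + cinner f h"
  using cinner_commute[of f "g + h"] cinner_commute[of f g] cinner_commute[of f h]
  by (simp add: cinner_add_left)

lemma cinner_zero_right: "cinner f 0 = 0"
  using cinner_add_right[of f 0 0] by simp

lemma cinner_sum_right: "cinner f (\<Sum>s\<in>S. g s) = (\<Sum>s\<in>S. cinner f (g s))"
  by (induction S rule: infinite_finite_induct) (simp_all add: cinner_zero_right cinner_add_right)

lemma cinner_right_inject:
  assumes "\<And>f. cinner f g = cinner f h"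
  shows "g = h"
proof -
  have "inner (g - h) (g - h) = inner (g - h) g - inner (g - h) h"
    by (rule inner_diff_right)
  also have "\<dots> = 0"
    using assms by (simp add: inner_L2_def)
  finally show ?thesis by simp
qed

text \<open>The real inner product determines the complex one. This reduces complex Riesz representation to the
  real case.\<close>

lemma cinner_eq_inner: "cinner f g = Complex (inner f g) (- inner (\<i> *\<^sub>C f) g)"
  by (simp add: complex_eq_iff inner_L2_def cinner_scaleC_left)

lemma adj_eqI:
  assumes "\<And>f g. cinner (S f) g = cinner f (T g)"
  shows "adj S = T"
  unfolding adj_def
proof (rule the_equality)
  show "\<forall>f g. cinner (S f) g = cinner f (T g)"
    using assms by simp
  fix U assume U: "\<forall>f g. cinner (S f) g = cinner f (U g)"
  then show "U = T"
    using assms by (intro ext cinner_right_inject) metis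
qed

text \<open>Riesz representation of \<open>h \<mapsto> \<langle>S h, g\<rangle>\<close>, applied to the real inner product, gives an adjoint for that
  inner product only; it is the Hilbert space adjoint because \<open>S\<close> commutes with multiplication by \<open>\<i>\<close>.\<close>

lemma cinner_adj:
  assumes "bounded_operator S"
  shows "cinner (S f) g = cinner f (adj S g)"
proof -
  have bl: "bounded_linear S" and C: "\<And>c f. S (c *\<^sub>C f) = c *\<^sub>C S f"
    using assms by (auto simp: bounded_operator_def)
  have "\<exists>t. \<forall>h. inner (S h) g = inner h t" for g
    using Riesz_representation_real[OF
        bounded_linear_compose[OF bounded_linear_inner_left bl], of g] by metis
  then obtain T where T: "\<And>h g. inner (S h) g = inner h (T g)"
    by metis
  have *: "cinner (S f) g = cinner f (T g)" for f g
    by (simp add: cinner_eq_inner T flip: C)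
  have "adj S = T"
    by (rule adj_eqI) (rule *)
  then show ?thesis by (simp add: *)
qed

lemma adj_adj:
  assumes "bounded_operator S"
  shows "adj (adj S) = S"
proof (rule adj_eqI)
  fix f g
  show "cinner (adj S f) g = cinner f (S g)"
    using cinner_commute[of "adj S f" g] cinner_commute[of f "S g"] cinner_adj[OF assms, of g f]
    by simp
qed

section \<open>Frames of linear combinations\<close>

lemma infsum_ennreal_cmult: "(\<Sum>\<^sub>\<infinity>x\<in>A. c * f x) = c * (\<Sum>\<^sub>\<infinity>x\<in>A. f x)" for f :: "'a \<Rightarrow> ennreal"
  by (simp add: nonneg_infsum_complete SUP_mult_left_ennreal sum_distrib_left)

lemma infsum_ennreal_sum:
  "(\<Sum>\<^sub>\<infinity>x\<in>A. \<Sum>s\<in>S. f s x) = (\<Sum>s\<in>S. \<Sum>\<^sub>\<infinity>x\<in>A. f s x)" for f :: "'s \<Rightarrow> 'a \<Rightarrow> ennreal"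
proof (induction S rule: infinite_finite_induct)
  case (insert s S)
  then show ?case
    by (simp add: infsum_add nonneg_summable_on_complete)
qed simp_all

text \<open>Termwise this is \<open>|\<Sum>\<^sub>s x\<^sub>s|\<^sup>2 \<le> n \<Sum>\<^sub>s |x\<^sub>s|\<^sup>2\<close> for \<open>n\<close> summands.\<close>

lemma frame_sum_combination_le:
  "frame_sum (\<lambda>j k m. \<Sum>s\<in>S. \<alpha> s *\<^sub>C g s j k m) f
    \<le> (\<Sum>s\<in>S. ennreal (card S * (cmod (\<alpha> s))\<^sup>2) * frame_sum (g s) f)"
proof -
  have pt: "(cmod (cinner f (\<Sum>s\<in>S. \<alpha> s *\<^sub>C h s)))\<^sup>2
      \<le> (\<Sum>s\<in>S. (card S * (cmod (\<alpha> s))\<^sup>2) * (cmod (cinner f (h s)))\<^sup>2)" for h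
  proof -
    have "cmod (cinner f (\<Sum>s\<in>S. \<alpha> s *\<^sub>C h s)) \<le> (\<Sum>s\<in>S. cmod (\<alpha> s) * cmod (cinner f (h s)))"
      unfolding cinner_sum_right cinner_scaleC_right
      by (rule order_trans[OF norm_sum]) (simp add: norm_mult)
    then have "(cmod (cinner f (\<Sum>s\<in>S. \<alpha> s *\<^sub>C h s)))\<^sup>2
        \<le> (\<Sum>s\<in>S. cmod (\<alpha> s) * cmod (cinner f (h s)))\<^sup>2"
      by (intro power_mono) auto
    also have "\<dots> \<le> (\<Sum>s\<in>S. (cmod (\<alpha> s) * cmod (cinner f (h s)))\<^sup>2) * card S"
      by (rule sum_squared_le_sum_of_squares)
    also have "\<dots> = (\<Sum>s\<in>S. (card S * (cmod (\<alpha> s))\<^sup>2) * (cmod (cinner f (h s)))\<^sup>2)"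
      by (simp add: sum_distrib_left sum_distrib_right power_mult_distrib mult_ac)
    finally show ?thesis .
  qed
  have "frame_sum (\<lambda>j k m. \<Sum>s\<in>S. \<alpha> s *\<^sub>C g s j k m) f
      \<le> (\<Sum>\<^sub>\<infinity>(j, k, m)\<in>UNIV. \<Sum>s\<in>S. ennreal (card S * (cmod (\<alpha> s))\<^sup>2)
            * ennreal ((cmod (cinner f (g s j k m)))\<^sup>2))"
    unfolding frame_sum_def
    by (intro infsum_mono nonneg_summable_on_complete)
      (auto simp: ennreal_mult[symmetric] sum_ennreal intro!: ennreal_leI pt)
  also have "\<dots> = (\<Sum>s\<in>S. ennreal (card S * (cmod (\<alpha> s))\<^sup>2) * frame_sum (g s) f)"
    unfolding frame_sum_def infsum_ennreal_cmult[symmetric] infsum_ennreal_sum[symmetric]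
    by (intro infsum_cong) auto
  finally show ?thesis .
qed

text \<open>The two frame bounds are measured against different quantities, \<open>\<parallel>\<Theta>\<^sup>* f\<parallel>\<close> and \<open>\<parallel>\<Theta> f\<parallel>\<close>. Comparing the
  upper bound of one family with the lower bound of another is what hyponormality of \<open>\<Theta>\<^sup>*\<close> makes possible.\<close>

theorem IWH_wave_packet_frame_combination_iff:
  assumes \<Theta>: "bounded_operator \<Theta>" "hyponormal (adj \<Theta>)"
    and S: "finite S" "S \<noteq> {}"
    and frames: "\<And>s. s \<in> S \<Longrightarrow> IWH_wave_packet_frame \<Theta> (g s)"
  shows "IWH_wave_packet_frame \<Theta> (\<lambda>j k m. \<Sum>s\<in>S. \<alpha> s *\<^sub>C g s j k m) \<longleftrightarrow>
    (\<exists>\<mu>::real. \<mu> > 0 \<and> (\<exists>\<xi>\<in>S. \<forall>f.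
       ennreal \<mu> * frame_sum (g \<xi>) f \<le> frame_sum (\<lambda>j k m. \<Sum>s\<in>S. \<alpha> s *\<^sub>C g s j k m) f))"
    (is "?frame \<longleftrightarrow> ?dom")
proof -
  let ?F = "\<lambda>j k m. \<Sum>s\<in>S. \<alpha> s *\<^sub>C g s j k m"
  have "\<exists>A B. 0 < A \<and> A \<le> B \<and>
      (\<forall>f. ennreal (A * (norm (adj \<Theta> f))\<^sup>2) \<le> frame_sum (g s) f \<and>
           frame_sum (g s) f \<le> ennreal (B * (norm (\<Theta> f))\<^sup>2))" if "s \<in> S" for s
    using frames[OF that] unfolding IWH_wave_packet_frame_def .
  then obtain A B where A: "\<And>s. s \<in> S \<Longrightarrow> 0 < A s" and AB: "\<And>s. s \<in> S \<Longrightarrow> A s \<le> B s"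
    and lower: "\<And>s f. s \<in> S \<Longrightarrow> ennreal (A s * (norm (adj \<Theta> f))\<^sup>2) \<le> frame_sum (g s) f"
    and upper: "\<And>s f. s \<in> S \<Longrightarrow> frame_sum (g s) f \<le> ennreal (B s * (norm (\<Theta> f))\<^sup>2)"
    by metis
  have B: "0 < B s" if "s \<in> S" for s
    using A[OF that] AB[OF that] by linarith
  have hypo: "norm (\<Theta> f) \<le> norm (adj \<Theta> f)" for f
    using \<Theta> adj_adj[OF \<Theta>(1)] by (simp add: hyponormal_def)
  show ?thesis
  proof
    assume ?frame
    then obtain A0 where "A0 > 0"
      and low: "\<And>f. ennreal (A0 * (norm (adj \<Theta> f))\<^sup>2) \<le> frame_sum ?F f"
      unfolding IWH_wave_packet_frame_def by auto
    obtain \<xi> where \<xi>: "\<xi> \<in> S" using S by auto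
    have "ennreal (A0 / B \<xi>) * frame_sum (g \<xi>) f \<le> frame_sum ?F f" for f
    proof -
      have "ennreal (A0 / B \<xi>) * frame_sum (g \<xi>) f
          \<le> ennreal (A0 / B \<xi>) * ennreal (B \<xi> * (norm (\<Theta> f))\<^sup>2)"
        by (intro mult_left_mono upper \<xi>) auto
      also have "\<dots> = ennreal (A0 * (norm (\<Theta> f))\<^sup>2)"
        using B[OF \<xi>] \<open>A0 > 0\<close> by (simp add: ennreal_mult[symmetric])
      also have "\<dots> \<le> ennreal (A0 * (norm (adj \<Theta> f))\<^sup>2)"
        using \<open>A0 > 0\<close> hypo by (intro ennreal_leI mult_left_mono power_mono) auto
      also note low
      finally show ?thesis .
    qed
    moreover have "A0 / B \<xi> > 0" using \<open>A0 > 0\<close> B[OF \<xi>] by simp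
    ultimately show ?dom using \<xi> by blast
  next
    assume ?dom
    then obtain \<mu> \<xi> where "\<mu> > 0" and \<xi>: "\<xi> \<in> S"
      and dom: "\<And>f. ennreal \<mu> * frame_sum (g \<xi>) f \<le> frame_sum ?F f"
      by blast
    define C where "C = (\<Sum>s\<in>S. (card S * (cmod (\<alpha> s))\<^sup>2) * B s)"
    have low: "ennreal (\<mu> * A \<xi> * (norm (adj \<Theta> f))\<^sup>2) \<le> frame_sum ?F f" for f
    proof -
      have "ennreal (\<mu> * A \<xi> * (norm (adj \<Theta> f))\<^sup>2)
          = ennreal \<mu> * ennreal (A \<xi> * (norm (adj \<Theta> f))\<^sup>2)"
        using \<open>\<mu> > 0\<close> A[OF \<xi>] by (simp add: ennreal_mult[symmetric] mult.assoc)
      also have "\<dots> \<le> ennreal \<mu> * frame_sum (g \<xi>) f"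
        by (intro mult_left_mono lower \<xi>) auto
      also note dom
      finally show ?thesis .
    qed
    \<comment> \<open>The maximum with \<open>\<mu> * A \<xi>\<close> ensures that the lower frame bound does not exceed the upper one.\<close>
    have up: "frame_sum ?F f \<le> ennreal (max C (\<mu> * A \<xi>) * (norm (\<Theta> f))\<^sup>2)" for f
    proof -
      have "frame_sum ?F f \<le> (\<Sum>s\<in>S. ennreal (card S * (cmod (\<alpha> s))\<^sup>2) * frame_sum (g s) f)"
        by (rule frame_sum_combination_le)
      also have "\<dots> \<le> (\<Sum>s\<in>S. ennreal (card S * (cmod (\<alpha> s))\<^sup>2)
                          * ennreal (B s * (norm (\<Theta> f))\<^sup>2))"
        by (intro sum_mono mult_left_mono upper) auto
      also have "\<dots> = (\<Sum>s\<in>S. ennreal ((card S * (cmod (\<alpha> s))\<^sup>2) * B s * (norm (\<Theta> f))\<^sup>2))"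
        using B by (intro sum.cong refl) (simp add: ennreal_mult[symmetric] less_imp_le mult.assoc)
      also have "\<dots> = ennreal (C * (norm (\<Theta> f))\<^sup>2)"
        using B by (subst sum_ennreal) (auto simp: C_def sum_distrib_right less_imp_le)
      also have "\<dots> \<le> ennreal (max C (\<mu> * A \<xi>) * (norm (\<Theta> f))\<^sup>2)"
        by (intro ennreal_leI mult_right_mono) auto
      finally show ?thesis .
    qed
    have "\<mu> * A \<xi> > 0" using \<open>\<mu> > 0\<close> A[OF \<xi>] by simp
    with low up show ?frame
      unfolding IWH_wave_packet_frame_def
      by (intro exI[of _ "\<mu> * A \<xi>"] exI[of _ "max C (\<mu> * A \<xi>)"]) auto
  qed
qed

lemma infsum_cinner_flipped_eq_frame_sum:
  "(\<Sum>\<^sub>\<infinity>(j, k, m)\<in>UNIV. ennreal ((cmod (cinner (g j k m) f))\<^sup>2)) = frame_sum g f"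
proof -
  have "cmod (cinner (g j k m) f) = cmod (cinner f (g j k m))" for j k m
    by (subst cinner_commute) simp
  then show ?thesis
    by (simp add: frame_sum_def)
qed

theorem theorem4p2:
  fixes a :: "int \<Rightarrow> real" and c :: "int \<Rightarrow> real" and b :: real
    and \<Theta> :: "L2 \<Rightarrow> L2" and p :: nat
    and \<psi> :: "nat \<Rightarrow> L2" and \<alpha> :: "nat \<Rightarrow> complex"
  assumes "\<And>j. a j > 0"
    and "b \<noteq> 0"
    and "bounded_operator \<Theta>"
    and "hyponormal (adj \<Theta>)"
    and "p \<ge> 1"
    and "\<And>s. s \<in> {1..p} \<Longrightarrow>
           IWH_wave_packet_frame \<Theta>
             (\<lambda>j k m. dilation (a j) (translation (b * of_int k) (modulation (c m) (\<psi> s))))"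
    and "\<And>s. s \<in> {1..p} \<Longrightarrow> \<alpha> s \<noteq> 0"
  shows "IWH_wave_packet_frame \<Theta>
           (\<lambda>j k m. \<Sum>s=1..p. \<alpha> s *\<^sub>C
              dilation (a j) (translation (b * of_int k) (modulation (c m) (\<psi> s))))
         \<longleftrightarrow>
         (\<exists>\<mu>::real. \<mu> > 0 \<and> (\<exists>\<xi>\<in>{1..p}. \<forall>f.
            ennreal \<mu> *
              (\<Sum>\<^sub>\<infinity>(j, k, m)\<in>UNIV. ennreal ((cmod (cinner
                 (dilation (a j) (translation (b * of_int k) (modulation (c m) (\<psi> \<xi>)))) f))\<^sup>2))
            \<le> (\<Sum>\<^sub>\<infinity>(j, k, m)\<in>UNIV. ennreal ((cmod (cinner
                 (\<Sum>s=1..p. \<alpha> s *\<^sub>C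
                    dilation (a j) (translation (b * of_int k) (modulation (c m) (\<psi> s)))) f))\<^sup>2))))"
proof -
  have "finite {1..p}" "{1..p} \<noteq> {}"
    using \<open>p \<ge> 1\<close> by auto
  from IWH_wave_packet_frame_combination_iff[OF assms(3,4) this assms(6)]
  show ?thesis
    unfolding infsum_cinner_flipped_eq_frame_sum[symmetric] .
qed

end
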